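(* Let $(X,\|\cdot\|)$ be a complex normed space. The angle $\angle$ on $X$ has the following properties. (An 1) $\angle$ is a continuous map from $(X\setminus\{0\})^2$ onto a subset of $\arccos(\mathcal{SQ})\subset\mathcal A$. For all $x,y\in X\setminus\{0\}$: (An 2) $\angle(x,x)=0$; (An 3) $\angle(-x,x)=\pi$; (An 4) $\angle(x,y)=\overline{\angle(y,x)}$; (An 5) for all real numbers $r,s>0$, $\angle(r x, s y)=\angle(x,y)$; (An 6) $\angle(-x,-y)=\angle(x,y)$; (An 7) $\angle(x,y)+\angle(-x,y)=\pi$. (An 8) For any two linearly independent vectors $x,y\in X$, the map $\Theta:\mathbb R\to\mathcal A$, $t\mapsto\angle(x,\,y+t x)$, is continuous and injective, with limits $\lim_{t\to-\infty}\Theta(t)=\pi$ and $\lim_{t\to\infty}\Theta(t)=0$.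
   Context: Let $(X,\|\cdot\|)$ be a complex normed vector space and let $i$ be the imaginary unit. The product $\langle\cdot\,|\,\cdot\rangle:X\times X\to\mathbb C$ is defined as follows: $\langle x|y\rangle:=0$ if $x=0$ or $y=0$, and otherwise $$\langle x|y\rangle:=\|x\|\,\|y\|\cdot\tfrac14\Big[\big\|\tfrac{x}{\|x\|}+\tfrac{y}{\|y\|}\big\|^2-\big\|\tfrac{x}{\|x\|}-\tfrac{y}{\|y\|}\big\|^2+i\Big(\big\|\tfrac{x}{\|x\|}+i\tfrac{y}{\|y\|}\big\|^2-\big\|\tfrac{x}{\|x\|}-i\tfrac{y}{\|y\|}\big\|^2\Big)\Big].$$ Let $\mathcal A:=\{a+ib\mid 0<a<\pi,\ b\in\mathbb R\}\cup\{0,\pi\}$ and $\mathcal B:=\mathbb C\setminus\{r\in\mathbb R\mid r<-1\text{ or }r>1\}$. The complex cosine restricts to a homeomorphism $\cos:\mathcal A\to\mathcal B$, and $\arccos:\mathcal B\to\mathcal A$ denotes its inverse. For $x,y\in X\setminus\{0\}$ the angle is the complex number $\angle(x,y):=\arccos\big(\langle x|y\rangle/(\|x\|\,\|y\|)\big)\in\mathcal A$ (the argument always lies in $\mathcal B$). The complex square is $\mathcal{SQ}:=\{r+is\in\mathbb C\mid -1\le r,s\le 1\}\subset\mathcal B$. *)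

theory Defs
  imports "HOL-Analysis.Analysis"
begin

section \<open>Complex normed spaces\<close>

text \<open>The underlying real normed space of a complex normed space is kept as the superclass, so
  that the norm topology and real scaling are those of the library.\<close>

class complex_normed_vector = real_normed_vector +
  fixes scaleC :: "complex \<Rightarrow> 'a \<Rightarrow> 'a"  (infixr \<open>*\<^sub>C\<close> 75)
  assumes scaleC_add_right: "a *\<^sub>C (x + y) = a *\<^sub>C x + a *\<^sub>C y"
    and scaleC_add_left: "(a + b) *\<^sub>C x = a *\<^sub>C x + b *\<^sub>C x"
    and scaleC_scaleC: "a *\<^sub>C b *\<^sub>C x = (a * b) *\<^sub>C x"
    and scaleC_of_real: "complex_of_real r *\<^sub>C x = r *\<^sub>R x"
    and norm_scaleC: "norm (a *\<^sub>C x) = cmod a * norm x"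

global_interpretation complex_vector:
  vector_space "scaleC :: complex \<Rightarrow> 'a \<Rightarrow> 'a::complex_normed_vector"
proof
  show "1 *\<^sub>C x = x" for x :: 'a
    using scaleC_of_real[of 1 x] by simp
qed (simp_all add: scaleC_add_right scaleC_add_left scaleC_scaleC)

instantiation complex :: complex_normed_vector
begin
definition scaleC_complex_def: "a *\<^sub>C (z::complex) = a * z"
instance
  by standard (simp_all add: scaleC_complex_def algebra_simps norm_mult scaleR_conv_of_real)
end

section \<open>The product\<close>

definition cprod :: "'a::complex_normed_vector \<Rightarrow> 'a \<Rightarrow> complex" where
  "cprod x y =
    (if x = 0 \<or> y = 0 then 0
     else let u = x /\<^sub>R norm x; v = y /\<^sub>R norm y in
       complex_of_real (norm x * norm y * (1/4)) *
         (complex_of_real ((norm (u + v))\<^sup>2 - (norm (u - v))\<^sup>2)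
          + \<i> * complex_of_real ((norm (u + \<i> *\<^sub>C v))\<^sup>2 - (norm (u - \<i> *\<^sub>C v))\<^sup>2)))"

section \<open>The complex arccosine\<close>

definition setA :: "complex set" where
  "setA = {z. 0 < Re z \<and> Re z < pi} \<union> {0, complex_of_real pi}"

definition setB :: "complex set" where
  "setB = UNIV - complex_of_real ` {r. r < -1 \<or> r > 1}"

definition complex_square :: "complex set" where
  "complex_square = {z. -1 \<le> Re z \<and> Re z \<le> 1 \<and> -1 \<le> Im z \<and> Im z \<le> 1}"

definition arccosC :: "complex \<Rightarrow> complex" where
  "arccosC = the_inv_into setA cos"

lemma inj_on_cos_setA: "inj_on cos setA"
proof (rule inj_on_inverseI[where g = Arccos])
  show "Arccos (cos z) = z" if "z \<in> setA" for z
    using that by (intro Arccos_cos) (auto simp: setA_def)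
qed

lemma setB_iff: "w \<in> setB \<longleftrightarrow> (Im w = 0 \<longrightarrow> \<bar>Re w\<bar> \<le> 1)"
  by (auto simp: setB_def complex_eq_iff image_iff)

lemma cos_setA: "cos ` setA = setB"
proof (intro equalityI subsetI)
  fix w assume "w \<in> cos ` setA"
  then obtain z where z: "z \<in> setA" and w: "w = cos z" by auto
  show "w \<in> setB"
  proof (cases "0 < Re z \<and> Re z < pi")
    case True
    then have "sin (Re z) > 0" by (simp add: sin_gt_zero)
    then have "Im w = 0 \<Longrightarrow> Im z = 0"
      by (auto simp: w Im_cos)
    then show ?thesis by (auto simp: setB_iff w Re_cos)
  next
    case False
    with z have "z = 0 \<or> z = complex_of_real pi" by (auto simp: setA_def)
    then show ?thesis by (auto simp: setB_iff w Re_cos)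
  qed
next
  fix w assume w: "w \<in> setB"
  define z where "z = (if Re (Arccos w) \<ge> 0 then Arccos w else - Arccos w)"
  have cz: "cos z = w" by (simp add: z_def)
  have re: "0 \<le> Re z" "Re z \<le> pi"
    using Re_Arccos_bounds[of w] by (auto simp: z_def)
  have "z \<in> setA"
  proof (cases "0 < Re z \<and> Re z < pi")
    case True
    then show ?thesis by (simp add: setA_def)
  next
    case False
    with re have r: "Re z = 0 \<or> Re z = pi" by auto
    then have "Im w = 0" by (auto simp: Im_cos simp flip: cz)
    with w have "\<bar>Re w\<bar> \<le> 1" by (simp add: setB_iff)
    moreover have "\<bar>Re w\<bar> = cosh (Im z)"
    proof -
      have "\<bar>Re w\<bar> = \<bar>cosh (Im z)\<bar>"
        using r by (auto simp: Re_cos cosh_field_def abs_mult simp flip: cz)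
      then show ?thesis using cosh_real_ge_1[of "Im z"] by linarith
    qed
    ultimately have "Im z = 0"
      using cosh_real_one_iff[of "Im z"] cosh_real_ge_1[of "Im z"] by linarith
    with r show ?thesis by (auto simp: setA_def complex_eq_iff)
  qed
  with cz show "w \<in> cos ` setA" by blast
qed

lemma arccosC_eq_Arccos:
  assumes "w \<in> setB"
  shows "arccosC w = Arccos w"
proof -
  from assms cos_setA obtain z where z: "z \<in> setA" "w = cos z" by blast
  have "Arccos (cos z) = z"
    using z(1) by (intro Arccos_cos) (auto simp: setA_def)
  moreover have "arccosC (cos z) = z"
    unfolding arccosC_def using z(1) by (simp add: the_inv_into_f_f inj_on_cos_setA)
  ultimately show ?thesis using z by simp
qed

section \<open>The angle\<close>

text \<open>Only meaningful for nonzero arguments.\<close>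

definition angle :: "'a::complex_normed_vector \<Rightarrow> 'a \<Rightarrow> complex" where
  "angle x y = arccosC (cprod x y / complex_of_real (norm x * norm y))"

lemma complex_square_subset_setB: "complex_square \<subseteq> setB"
  by (auto simp: complex_square_def setB_iff)

lemma cprod_normalized_in_complex_square:
  fixes x y :: "'a::complex_normed_vector"
  assumes "x \<noteq> 0" "y \<noteq> 0"
  shows "cprod x y / complex_of_real (norm x * norm y) \<in> complex_square"
proof -
  define u v where "u = x /\<^sub>R norm x" and "v = y /\<^sub>R norm y"
  have n: "norm u = 1" "norm v = 1" "norm (\<i> *\<^sub>C v) = 1"
    using assms by (simp_all add: u_def v_def norm_scaleC)
  have b: "\<bar>(norm (u + w))\<^sup>2 - (norm (u - w))\<^sup>2\<bar> \<le> 4" if "norm w = 1" for w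
  proof -
    have "norm (u + w) \<le> 2" "norm (u - w) \<le> 2"
      using norm_triangle_ineq[of u w] norm_triangle_ineq4[of u w] n that by auto
    then have "(norm (u + w))\<^sup>2 \<le> 2\<^sup>2" "(norm (u - w))\<^sup>2 \<le> 2\<^sup>2"
      by (intro power_mono; simp)+
    then have "(norm (u + w))\<^sup>2 \<le> 4" "(norm (u - w))\<^sup>2 \<le> 4"
      by simp_all
    then show ?thesis
      using zero_le_power2[of "norm (u + w)"] zero_le_power2[of "norm (u - w)"]
      by linarith
  qed
  have "cprod x y / complex_of_real (norm x * norm y) =
    Complex (((norm (u + v))\<^sup>2 - (norm (u - v))\<^sup>2) / 4)
      (((norm (u + \<i> *\<^sub>C v))\<^sup>2 - (norm (u - \<i> *\<^sub>C v))\<^sup>2) / 4)"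
    using assms
    by (simp add: cprod_def Let_def u_def v_def Complex_eq field_simps)
  then show ?thesis
    using b[OF n(2)] b[OF n(3)] by (simp add: complex_square_def abs_le_iff)
qed

end

theory Submission
  imports Defs
begin

text \<open>
  The normalized product of \<open>x\<close> and \<open>y\<close> depends only on the unit vectors \<open>sgn x\<close> and \<open>sgn y\<close>, so
  the symmetries of the angle come from those of the polarization expression together with
  \<open>arccos (- w) = \<pi> - arccos w\<close> and \<open>arccos (cnj w) = cnj (arccos w)\<close>.
  For injectivity in (An 8) the real part of the product suffices. Let \<open>u\<close> be the direction of \<open>x\<close>
  and \<open>v\<close>, \<open>w\<close> the directions of \<open>y + t x\<close> for two parameters \<open>t\<close>, \<open>w\<close> belonging to the larger one.
  Then \<open>w = a v + b u\<close> with \<open>a, b > 0\<close>, and convexity of the norm gives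
  \<open>\<parallel>u + v\<parallel> \<le> \<parallel>u + w\<parallel>\<close> and \<open>\<parallel>u - w\<parallel> \<le> \<parallel>u - v\<parallel>\<close>. Equality in either determines the norms, and equality
  in both violates the triangle inequality for \<open>(1 + a + b) u = (u + w) + a (u - v)\<close>.
\<close>

section \<open>The complex arccosine\<close>

lemma arccosC_in_setA: "w \<in> setB \<Longrightarrow> arccosC w \<in> setA"
  unfolding arccosC_def using the_inv_into_into[OF inj_on_cos_setA] cos_setA by blast

lemma cos_arccosC: "w \<in> setB \<Longrightarrow> cos (arccosC w) = w"
  unfolding arccosC_def using f_the_inv_into_f[OF inj_on_cos_setA] cos_setA by blast

lemma arccosC_unique: "z \<in> setA \<Longrightarrow> cos z = w \<Longrightarrow> arccosC w = z"
  unfolding arccosC_def using the_inv_into_f_f[OF inj_on_cos_setA] by blast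

lemma uminus_in_setB_iff [simp]: "- w \<in> setB \<longleftrightarrow> w \<in> setB"
  by (simp add: setB_iff)

lemma cnj_in_setB_iff [simp]: "cnj w \<in> setB \<longleftrightarrow> w \<in> setB"
  by (simp add: setB_iff)

text \<open>The half-turn about \<pi>/2 maps \<open>setA\<close> to itself and turns
  \<open>cos\<close> into its negative.\<close>

lemma arccosC_minus:
  assumes "w \<in> setB"
  shows "arccosC (- w) = complex_of_real pi - arccosC w"
proof (rule arccosC_unique)
  show "complex_of_real pi - arccosC w \<in> setA"
    using arccosC_in_setA[OF assms] by (auto simp: setA_def)
  show "cos (complex_of_real pi - arccosC w) = - w"
    using cos_arccosC[OF assms] by (simp add: cos_diff flip: cos_of_real sin_of_real)
qed

lemma arccosC_cnj:
  assumes "w \<in> setB"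
  shows "arccosC (cnj w) = cnj (arccosC w)"
proof (rule arccosC_unique)
  show "cnj (arccosC w) \<in> setA"
    using arccosC_in_setA[OF assms] by (auto simp: setA_def)
  show "cos (cnj (arccosC w)) = cnj w"
    using cos_arccosC[OF assms] by (simp flip: cnj_cos)
qed

lemma arccosC_1: "arccosC 1 = 0"
  by (rule arccosC_unique) (auto simp: setA_def)

lemma inj_on_arccosC: "inj_on arccosC setB"
  by (rule inj_on_inverseI[where g = cos]) (rule cos_arccosC)

text \<open>At 1 the branch point of the square root is harmless, and the logarithm is taken near 1.\<close>

lemma isCont_Arccos_1: "isCont Arccos 1"
proof -
  have "((\<lambda>z. csqrt (1 - z\<^sup>2)) \<longlongrightarrow> 0) (at (1::complex))"
  \<comment> \<open>The modulus of \<open>csqrt\<close> is the continuous real root of the modulus,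
    so the limit is 0 from whichever side of the branch cut the argument approaches.\<close>
  proof (rule tendsto_norm_zero_cancel)
    have "((\<lambda>z. sqrt (cmod (1 - z\<^sup>2))) \<longlongrightarrow> sqrt (cmod (1 - 1\<^sup>2))) (at (1::complex))"
      by (intro tendsto_intros)
    then show "((\<lambda>z. norm (csqrt (1 - z\<^sup>2))) \<longlongrightarrow> 0) (at (1::complex))" by simp
  qed
  then have "((\<lambda>z. z + \<i> * csqrt (1 - z\<^sup>2)) \<longlongrightarrow> 1 + \<i> * 0) (at 1)"
    by (intro tendsto_intros)
  from tendsto_mult[OF tendsto_const[of "- \<i>"] tendsto_Ln[OF this]]
  have "((\<lambda>z. - \<i> * Ln (z + \<i> * csqrt (1 - z\<^sup>2))) \<longlongrightarrow> - \<i> * Ln (1 + \<i> * 0)) (at 1)"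
    by simp
  then have "(Arccos \<longlongrightarrow> Arccos 1) (at 1)"
    unfolding Arccos_def by (simp only: power_one diff_self csqrt_0)
  then show ?thesis
    by (simp only: isCont_def)
qed

text \<open>\<open>Arccos\<close> jumps at -1, but its restriction to \<open>setB\<close> does not, by reflection.\<close>

lemma continuous_on_arccosC: "continuous_on setB arccosC"
  unfolding continuous_on_eq_continuous_within
proof
  fix w assume w: "w \<in> setB"
  have cont: "continuous (at c within setB) arccosC" if "c \<in> setB" "isCont Arccos c" for c
  \<comment> \<open>The two functions agree on all of \<open>setB\<close>, so any radius serves; 1
    is taken.\<close>
  proof (rule continuous_transform_within)
    show "continuous (at c within setB) Arccos"
      using that(2) by (rule continuous_at_imp_continuous_within)
  qed (auto simp: that arccosC_eq_Arccos intro: zero_less_one)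
  consider "w = 1" | "w = -1" | "Im w = 0 \<Longrightarrow> \<bar>Re w\<bar> < 1"
  proof (cases "Im w = 0 \<and> \<bar>Re w\<bar> = 1")
    case True
    then have "w = 1 \<or> w = -1" by (auto simp: complex_eq_iff abs_if split: if_splits)
    then show thesis using that by blast
  next
    case False
    then show thesis using w that(3) by (fastforce simp: setB_iff)
  qed
  then show "continuous (at w within setB) arccosC"
  proof cases
    case 1
    then show ?thesis using w cont isCont_Arccos_1 by blast
  next
    case 2
    have "continuous (at 1 within setB) arccosC"
      using cont[of 1] isCont_Arccos_1 by (simp add: setB_iff)
    \<comment> \<open>Symmetry of \<open>setB\<close> carries the relative neighbourhoods of -1 to
      those of 1.\<close>
    moreover have "uminus ` setB = setB"
      using surj_image_vimage_eq[of uminus setB] by (simp add: vimage_def surj_uminus)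
    ultimately have "continuous (at (-1) within setB) (\<lambda>w. arccosC (- w))"
      by (intro continuous_within_compose2[where g = arccosC and f = uminus])
        (auto intro: continuous_intros)
    then have "continuous (at (-1) within setB) (\<lambda>w. complex_of_real pi - arccosC (- w))"
      by (intro continuous_intros)
    then show ?thesis
      unfolding 2
      by (rule continuous_transform_within[OF _ zero_less_one])
        (auto simp: arccosC_minus setB_iff)
  next
    case 3
    then show ?thesis using w by (intro cont isCont_Arccos) auto
  qed
qed

text \<open>Injectivity of \<open>arccosC\<close> reduces properness to a point of
  \<open>setB\<close> outside the square; \<open>2 * \<i>\<close> is one.\<close>

lemma arccosC_complex_square_psubset: "arccosC ` complex_square \<subset> setA"
proof
  show "arccosC ` complex_square \<subseteq> setA"
    using arccosC_in_setA complex_square_subset_setB by blast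
  have "2 * \<i> \<in> setB" "2 * \<i> \<notin> complex_square"
    by (auto simp: setB_iff complex_square_def)
  then have "arccosC (2 * \<i>) \<in> setA" "arccosC (2 * \<i>) \<notin> arccosC ` complex_square"
    using arccosC_in_setA inj_on_image_mem_iff[OF inj_on_arccosC _ complex_square_subset_setB]
    by blast+
  then show "arccosC ` complex_square \<noteq> setA" by blast
qed

section \<open>The normalized product\<close>

lemma bounded_linear_scaleC: "bounded_linear ((*\<^sub>C) a :: 'a::complex_normed_vector \<Rightarrow> 'a)"
proof (rule bounded_linear_intro[where K = "cmod a"])
  show "a *\<^sub>C (r *\<^sub>R x) = r *\<^sub>R (a *\<^sub>C x)" for r and x :: 'a
    by (simp add: scaleC_scaleC mult.commute flip: scaleC_of_real)
qed (simp_all add: scaleC_add_right norm_scaleC)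

text \<open>The polarization expression, which is the inner product when the norm comes from one.
  Writing it with \<open>Complex\<close> lets real and imaginary parts be treated
  separately.\<close>

definition polar :: "'a::complex_normed_vector \<Rightarrow> 'a \<Rightarrow> complex" where
  "polar u v = Complex (((norm (u + v))\<^sup>2 - (norm (u - v))\<^sup>2) / 4)
    (((norm (u + \<i> *\<^sub>C v))\<^sup>2 - (norm (u - \<i> *\<^sub>C v))\<^sup>2) / 4)"

lemma cprod_eq_polar:
  assumes "x \<noteq> 0" "y \<noteq> 0"
  shows "cprod x y / complex_of_real (norm x * norm y) = polar (sgn x) (sgn y)"
  using assms
  by (simp add: cprod_def polar_def Let_def sgn_div_norm[symmetric] Complex_eq add_divide_distrib)

lemma angle_eq: "x \<noteq> 0 \<Longrightarrow> y \<noteq> 0 \<Longrightarrow> angle x y = arccosC (polar (sgn x) (sgn y))"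
  by (simp only: angle_def cprod_eq_polar not_False_eq_True)

lemma polar_sgn_in_complex_square:
  "x \<noteq> 0 \<Longrightarrow> y \<noteq> 0 \<Longrightarrow> polar (sgn x) (sgn y) \<in> complex_square"
  using cprod_normalized_in_complex_square[of x y] by (simp only: cprod_eq_polar not_False_eq_True)

lemma polar_sgn_in_setB: "x \<noteq> 0 \<Longrightarrow> y \<noteq> 0 \<Longrightarrow> polar (sgn x) (sgn y) \<in> setB"
  using polar_sgn_in_complex_square complex_square_subset_setB by blast

text \<open>Multiplication by \<open>\<i>\<close> is an isometry. This exchanges the two norms in
  the imaginary part of \<open>polar\<close> when the arguments are swapped, which is the source of
  Hermitian symmetry.\<close>

lemma norm_add_ii: "norm (u + \<i> *\<^sub>C v) = norm (v - \<i> *\<^sub>C u)" for u :: "'a::complex_normed_vector"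
proof -
  have "\<i> *\<^sub>C (v - \<i> *\<^sub>C u) = u + \<i> *\<^sub>C v"
    by (simp add: complex_vector.scale_right_diff_distrib scaleC_scaleC complex_vector.scale_minus_left)
  then show ?thesis
    using norm_scaleC[of "\<i>" "v - \<i> *\<^sub>C u"] by simp
qed

lemma polar_cnj: "polar v u = cnj (polar u v)"
  using norm_add_ii[of u v] norm_add_ii[of v u]
  by (simp add: polar_def complex_eq_iff add.commute norm_minus_commute diff_divide_distrib)

lemma polar_minus_right: "polar u (- v) = - polar u v"
  by (simp add: polar_def complex_eq_iff complex_vector.scale_minus_right diff_divide_distrib)

lemma polar_minus_left: "polar (- u) v = - polar u v"
  using polar_minus_right[of v u] by (simp add: polar_cnj[of _ v])

lemma polar_self: "polar u u = complex_of_real ((norm u)\<^sup>2)"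
proof -
  have "norm (u + u) = 2 * norm u"
    by (simp flip: scaleR_2)
  then show ?thesis
    using norm_add_ii[of u u] by (simp add: polar_def complex_eq_iff power_mult_distrib)
qed

lemma continuous_on_polar:
  assumes "continuous_on S f" "continuous_on S g"
  shows "continuous_on S (\<lambda>x. polar (f x) (g x))"
proof -
  note [continuous_intros] = bounded_linear.continuous_on[OF bounded_linear_scaleC]
  show ?thesis
    unfolding polar_def Complex_eq by (intro continuous_intros assms) simp_all
qed

section \<open>Properties of the angle\<close>

lemma angle_in_image: "x \<noteq> 0 \<Longrightarrow> y \<noteq> 0 \<Longrightarrow> angle x y \<in> arccosC ` complex_square"
  by (simp add: angle_eq polar_sgn_in_complex_square)

lemma angle_in_setA: "x \<noteq> 0 \<Longrightarrow> y \<noteq> 0 \<Longrightarrow> angle x y \<in> setA"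
  by (simp add: angle_eq arccosC_in_setA polar_sgn_in_setB)

text \<open>Stated for composed maps so that it serves both for the pair of projections and for a
  line \<open>y + t x\<close>.\<close>

lemma continuous_on_angle:
  assumes "continuous_on S f" "continuous_on S g"
    and "\<And>x. x \<in> S \<Longrightarrow> f x \<noteq> 0" "\<And>x. x \<in> S \<Longrightarrow> g x \<noteq> 0"
  shows "continuous_on S (\<lambda>x. angle (f x) (g x))"
proof -
  have "continuous_on S (\<lambda>x. arccosC (polar (sgn (f x)) (sgn (g x))))"
    using assms
    by (intro continuous_on_compose2[OF continuous_on_arccosC] continuous_on_polar
        continuous_on_sgn) (auto simp: polar_sgn_in_setB)
  then show ?thesis
    using assms(3,4) by (simp add: angle_eq cong: continuous_on_cong)
qed

lemma angle_self: "x \<noteq> 0 \<Longrightarrow> angle x x = 0"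
  by (simp add: angle_eq polar_self norm_sgn arccosC_1)

lemma angle_minus_left:
  "x \<noteq> 0 \<Longrightarrow> y \<noteq> 0 \<Longrightarrow> angle (- x) y = complex_of_real pi - angle x y"
  by (simp add: angle_eq sgn_minus polar_minus_left arccosC_minus polar_sgn_in_setB)

lemma angle_minus_minus: "x \<noteq> 0 \<Longrightarrow> y \<noteq> 0 \<Longrightarrow> angle (- x) (- y) = angle x y"
  by (simp add: angle_eq sgn_minus polar_minus_left polar_minus_right)

lemma angle_cnj: "x \<noteq> 0 \<Longrightarrow> y \<noteq> 0 \<Longrightarrow> angle x y = cnj (angle y x)"
  by (simp add: angle_eq arccosC_cnj[symmetric] polar_sgn_in_setB polar_cnj[of "sgn x" "sgn y"])

lemma angle_scaleR:
  "x \<noteq> 0 \<Longrightarrow> y \<noteq> 0 \<Longrightarrow> r > 0 \<Longrightarrow> s > 0 \<Longrightarrow> angle (r *\<^sub>R x) (s *\<^sub>R y) = angle x y"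
  by (simp add: angle_eq sgn_scaleR)

section \<open>Monotonicity on the unit circle of a real plane\<close>

text \<open>The triangle inequality is applied to three ways of rewriting positive combinations of
  \<open>u\<close>, \<open>v\<close>, \<open>w\<close>. \<open>lower\<close> bounds
  \<open>b * norm (u + w)\<close> from below; \<open>upper\<close> and \<open>upper'\<close> bound
  \<open>norm (u + v)\<close> from above, split so that \<open>b - a\<close> or \<open>a - b\<close>
  is nonnegative. If the two norms agree, these bounds meet and fix their value.\<close>

lemma norm_add_unit_mono:
  fixes u v w :: "'a::real_normed_vector"
  assumes unit: "norm u = 1" "norm v = 1" "norm w = 1"
    and w: "w = a *\<^sub>R v + b *\<^sub>R u" and ab: "a > 0" "b > 0"
  shows "norm (u + v) \<le> norm (u + w)"
    and "norm (u + v) = norm (u + w) \<Longrightarrow> b * norm (u + w) = b + 1 - a"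
proof -
  let ?N = "norm (u + v)" and ?M = "norm (u + w)"
  have lower: "1 + b \<le> b * ?M + a"
  proof -
    have "(1 + b) *\<^sub>R w = b *\<^sub>R (u + w) + a *\<^sub>R v"
      by (simp add: w algebra_simps)
    then have "norm ((1 + b) *\<^sub>R w) \<le> norm (b *\<^sub>R (u + w)) + norm (a *\<^sub>R v)"
      by (metis norm_triangle_ineq)
    then show ?thesis using unit ab by simp
  qed
  \<comment> \<open>Makes the coefficient \<open>1 - a + b\<close> in \<open>upper'\<close>
    nonnegative.\<close>
  have "a \<le> 1 + b"
  proof -
    have "a *\<^sub>R v = w - b *\<^sub>R u" by (simp add: w)
    then have "norm (a *\<^sub>R v) \<le> norm w + norm (b *\<^sub>R u)"
      by (metis norm_triangle_ineq4)
    then show ?thesis using unit ab by simp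
  qed
  have upper: "b * ?N \<le> b - a + 1" if "a \<le> b"
  proof -
    have "b *\<^sub>R (u + v) = (b - a) *\<^sub>R v + w"
      by (simp add: w algebra_simps)
    then have "norm (b *\<^sub>R (u + v)) \<le> norm ((b - a) *\<^sub>R v) + norm w"
      by (metis norm_triangle_ineq)
    then show ?thesis using unit ab that by simp
  qed
  have upper': "a * ?N \<le> (1 - a + b) + (a - b) * ?M" if "b \<le> a"
  proof -
    have "a *\<^sub>R (u + v) = (1 - a + b) *\<^sub>R w + (a - b) *\<^sub>R (u + w)"
      by (simp add: w algebra_simps)
    then have "norm (a *\<^sub>R (u + v)) \<le> norm ((1 - a + b) *\<^sub>R w) + norm ((a - b) *\<^sub>R (u + w))"
      by (metis norm_triangle_ineq)
    then show ?thesis using unit ab that \<open>a \<le> 1 + b\<close> by simp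
  qed
  have "b * ?N \<le> b * ?M \<or> a * ?N \<le> a * ?M"
    using lower upper upper' by (cases "a \<le> b") (auto simp: left_diff_distrib)
  then show "?N \<le> ?M" using ab by simp
  show "b * ?M = b + 1 - a" if "?N = ?M"
    using lower upper upper' that by (cases "a \<le> b") (auto simp: left_diff_distrib)
qed

lemma norm_add_diff_unit_strict_mono:
  fixes u v w :: "'a::real_normed_vector"
  assumes unit: "norm u = 1" "norm v = 1" "norm w = 1"
    and w: "w = a *\<^sub>R v + b *\<^sub>R u" and ab: "a > 0" "b > 0"
    and ne: "v \<noteq> u" "w \<noteq> - u"
  shows "(norm (u + v))\<^sup>2 - (norm (u - v))\<^sup>2 < (norm (u + w))\<^sup>2 - (norm (u - w))\<^sup>2"
proof -
  let ?M = "norm (u + w)" and ?K = "norm (u - v)"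
  \<comment> \<open>The estimate for differences is the estimate for sums with \<open>- u\<close> in
    place of \<open>u\<close> and with \<open>v\<close> and \<open>w\<close> exchanged.\<close>
  have v: "v = (1 / a) *\<^sub>R w + (b / a) *\<^sub>R (- u)"
    using ab by (simp add: w scaleR_add_right)
  note plus = norm_add_unit_mono[OF unit w ab]
  have "norm (- u + w) = norm (u - w)" "norm (- u + v) = ?K"
    by (simp_all add: norm_minus_commute)
  then have minus: "norm (u - w) \<le> ?K"
    and "norm (u - w) = ?K \<Longrightarrow> b / a * ?K = b / a + 1 - 1 / a"
    using norm_add_unit_mono[OF _ unit(3,2) v] unit(1) ab by simp_all
  then have "norm (u - w) = ?K \<Longrightarrow> (b * ?K) / a = (b + a - 1) / a"
    using ab by (simp add: add_divide_distrib diff_divide_distrib)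
  then have minus_eq: "norm (u - w) = ?K \<Longrightarrow> b * ?K = b + a - 1"
    using ab by simp
  have "norm (u + v) < ?M \<or> norm (u - w) < ?K"
  proof (rule ccontr)
    assume "\<not> ?thesis"
    then have M: "b * ?M = b + 1 - a" and K: "b * ?K = b + a - 1"
      using plus minus minus_eq by auto
    have "(1 + a + b) *\<^sub>R u = (u + w) + a *\<^sub>R (u - v)"
      by (simp add: w algebra_simps)
    then have "norm ((1 + a + b) *\<^sub>R u) \<le> norm (u + w) + norm (a *\<^sub>R (u - v))"
      by (metis norm_triangle_ineq)
    then have "1 + a + b \<le> ?M + a * ?K"
      using unit ab by simp
    then have "b * (1 + a + b) \<le> b * ?M + a * (b * ?K)"
      using ab by (metis distrib_left mult.left_commute mult_left_mono less_imp_le)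
    then have "b\<^sup>2 \<le> (1 - a)\<^sup>2"
      by (simp add: M K power2_eq_square algebra_simps)
    \<comment> \<open>Positivity of both norms, inserted in \<open>M\<close> and \<open>K\<close>,
      says \<open>a - 1 < b\<close> and \<open>1 - a < b\<close>, against the bound just
      found.\<close>
    moreover have "u + w \<noteq> 0" "u - v \<noteq> 0"
      using ne by (simp_all add: add_eq_0_iff)
    then have "b * ?M > 0" "b * ?K > 0"
      using ab by simp_all
    then have "\<bar>1 - a\<bar> < \<bar>b\<bar>" using M K ab by linarith
    then have "(1 - a)\<^sup>2 < b\<^sup>2" by (metis abs_ge_zero power2_abs power_strict_mono zero_less_numeral)
    ultimately show False by simp
  qed
  moreover have "(norm (u + v))\<^sup>2 \<le> ?M\<^sup>2" "(norm (u - w))\<^sup>2 \<le> ?K\<^sup>2"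
    using plus minus by (auto intro: power_mono)
  moreover have "norm (u + v) < ?M \<Longrightarrow> (norm (u + v))\<^sup>2 < ?M\<^sup>2"
    "norm (u - w) < ?K \<Longrightarrow> (norm (u - w))\<^sup>2 < ?K\<^sup>2"
    by (auto intro: power_strict_mono)
  ultimately show ?thesis by linarith
qed

section \<open>The angle along a line\<close>

lemma Re_polar_sgn_strict_mono:
  fixes x y :: "'a::complex_normed_vector"
  assumes x: "x \<noteq> 0" and indep: "\<And>r::real. y \<noteq> r *\<^sub>R x"
  shows "strict_mono (\<lambda>t. Re (polar (sgn x) (sgn (y + t *\<^sub>R x))))"
proof (rule strict_monoI)
  fix s t :: real assume st: "s < t"
  have indep': "y + r *\<^sub>R x \<noteq> c *\<^sub>R x" for r c
    using indep[of "c - r"] by (auto simp: algebra_simps)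
  define p q where "p = y + s *\<^sub>R x" and "q = y + t *\<^sub>R x"
  have p: "p \<noteq> c *\<^sub>R x" and q: "q \<noteq> c *\<^sub>R x" for c
    by (simp_all add: p_def q_def indep')
  have pq0: "p \<noteq> 0" "q \<noteq> 0" using p[of 0] q[of 0] by auto
  \<comment> \<open>Normalizing \<open>q = p + (t - s) x\<close> gives positive coefficients because
    \<open>s < t\<close>.\<close>
  have comb: "sgn q = (norm p / norm q) *\<^sub>R sgn p + ((t - s) * norm x / norm q) *\<^sub>R sgn x"
  proof -
    have "q = norm p *\<^sub>R sgn p + ((t - s) * norm x) *\<^sub>R sgn x"
      using x pq0 by (simp add: sgn_div_norm) (simp add: p_def q_def algebra_simps)
    then have "sgn q = inverse (norm q) *\<^sub>R (norm p *\<^sub>R sgn p + ((t - s) * norm x) *\<^sub>R sgn x)"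
      by (metis sgn_div_norm)
    then show ?thesis
      by (simp add: scaleR_add_right divide_inverse mult.commute)
  qed
  have ne: "sgn p \<noteq> sgn x" "sgn q \<noteq> - sgn x"
  proof -
    have eq: "p = norm p *\<^sub>R sgn p" "q = norm q *\<^sub>R sgn q"
      using pq0 by (simp_all add: sgn_div_norm)
    show "sgn p \<noteq> sgn x"
      using p[of "norm p / norm x"] eq(1) by (metis divide_inverse scaleR_scaleR sgn_div_norm)
    show "sgn q \<noteq> - sgn x"
      using q[of "- (norm q / norm x)"] eq(2)
      by (metis divide_inverse scaleR_minus_left scaleR_minus_right scaleR_scaleR sgn_div_norm)
  qed
  have "(norm (sgn x + sgn p))\<^sup>2 - (norm (sgn x - sgn p))\<^sup>2
      < (norm (sgn x + sgn q))\<^sup>2 - (norm (sgn x - sgn q))\<^sup>2"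
    using x pq0 st
    by (intro norm_add_diff_unit_strict_mono[OF _ _ _ comb _ _ ne]) (simp_all add: norm_sgn)
  then show "Re (polar (sgn x) (sgn (y + s *\<^sub>R x))) < Re (polar (sgn x) (sgn (y + t *\<^sub>R x)))"
    by (simp add: polar_def divide_strict_right_mono flip: p_def q_def)
qed

text \<open>For \<open>t > 0\<close> the angle is unchanged when \<open>y + t x\<close> is divided
  by \<open>t\<close>, and \<open>y / t + x\<close> tends to \<open>x\<close>, where the angle is 0.
  The point may vanish for some \<open>t\<close>, but not for large ones.\<close>

lemma angle_line_at_top:
  fixes x y :: "'a::complex_normed_vector"
  assumes x: "x \<noteq> 0"
  shows "((\<lambda>t::real. angle x (y + t *\<^sub>R x)) \<longlongrightarrow> 0) at_top"
proof -
  have "((\<lambda>t. inverse t *\<^sub>R y + x) \<longlongrightarrow> 0 *\<^sub>R y + x) at_top"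
    by (intro tendsto_intros tendsto_inverse_0_at_top filterlim_ident)
  then have lim: "((\<lambda>t. inverse t *\<^sub>R y + x) \<longlongrightarrow> x) at_top" by simp
  have "isCont (angle x) x"
  proof -
    have "continuous_on (- {0}) (angle x)"
      using x by (intro continuous_on_angle continuous_intros) auto
    then show ?thesis
      using x continuous_on_eq_continuous_at[of "- {0}" "angle x"] by (simp add: open_Compl)
  qed
  then have "((\<lambda>t. angle x (inverse t *\<^sub>R y + x)) \<longlongrightarrow> angle x x) at_top"
    by (rule isCont_tendsto_compose) (rule lim)
  moreover have "\<forall>\<^sub>F t in at_top. angle x (inverse t *\<^sub>R y + x) = angle x (y + t *\<^sub>R x)"
    using tendsto_imp_eventually_ne[OF lim x] eventually_gt_at_top[of 0]
  proof eventually_elim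
    case (elim t)
    have "y + t *\<^sub>R x = t *\<^sub>R (inverse t *\<^sub>R y + x)"
      using elim by (simp add: scaleR_add_right)
    then show ?case
      using angle_scaleR[of x "inverse t *\<^sub>R y + x" 1 t] elim x by simp
  qed
  ultimately show ?thesis
    using x by (simp add: angle_self tendsto_cong)
qed

text \<open>Replacing \<open>t\<close> and \<open>x\<close> by their negatives leaves the line
  unchanged and reduces to the limit at \<open>at_top\<close>.\<close>

lemma angle_line_at_bot:
  fixes x y :: "'a::complex_normed_vector"
  assumes x: "x \<noteq> 0" and ne: "\<And>t::real. y + t *\<^sub>R x \<noteq> 0"
  shows "((\<lambda>t::real. angle x (y + t *\<^sub>R x)) \<longlongrightarrow> complex_of_real pi) at_bot"
proof -
  have "angle x (y + (- t) *\<^sub>R x) = complex_of_real pi - angle (- x) (y + t *\<^sub>R (- x))" for t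
    using angle_minus_left[of x "y + (- t) *\<^sub>R x"] ne[of "- t"] x by simp
  moreover have "((\<lambda>t. complex_of_real pi - angle (- x) (y + t *\<^sub>R (- x))) \<longlongrightarrow>
      complex_of_real pi - 0) at_top"
    using x by (intro tendsto_intros angle_line_at_top) simp
  ultimately show ?thesis
    by (simp add: filterlim_at_bot_mirror)
qed

text \<open>Only real multiples matter along the line. The hypothesis \<open>x \<noteq> y\<close>
  rules out the collapse of \<open>{x, y}\<close> to a singleton, which is independent for every
  nonzero vector.\<close>

lemma complex_independent_pair:
  fixes x y :: "'a::complex_normed_vector"
  assumes "x \<noteq> y" "complex_vector.independent {x, y}"
  shows "x \<noteq> 0" and "y \<noteq> r *\<^sub>R x"
proof -
  show "x \<noteq> 0"
    using assms(2) complex_vector.dependent_zero by blast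
  have "y \<notin> complex_vector.span {x}"
    using assms complex_vector.independent_insert[of y "{x}"] by (auto simp: insert_commute)
  then show "y \<noteq> r *\<^sub>R x"
    using complex_vector.span_scale[OF complex_vector.span_base, of x "{x}" "complex_of_real r"]
    by (auto simp: scaleC_of_real)
qed

text \<open>Since \<open>arccosC\<close> is injective on \<open>setB\<close>, equal angles force
  equal products, whose real part is strictly increasing in \<open>t\<close>.\<close>

lemma inj_angle_line:
  fixes x y :: "'a::complex_normed_vector"
  assumes x: "x \<noteq> 0" and indep: "\<And>r::real. y \<noteq> r *\<^sub>R x"
  shows "inj (\<lambda>t::real. angle x (y + t *\<^sub>R x))"
proof (rule injI)
  fix s t :: real assume eq: "angle x (y + s *\<^sub>R x) = angle x (y + t *\<^sub>R x)"
  have ne: "y + r *\<^sub>R x \<noteq> 0" for r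
    using indep[of "- r"] by (auto simp: add_eq_0_iff2)
  have "polar (sgn x) (sgn (y + s *\<^sub>R x)) = polar (sgn x) (sgn (y + t *\<^sub>R x))"
    using eq inj_onD[OF inj_on_arccosC] by (simp add: angle_eq x ne polar_sgn_in_setB)
  then show "s = t"
    using strict_mono_eq[OF Re_polar_sgn_strict_mono[OF x indep]] by fastforce
qed

theorem theorem1p3:
  shows
    "(continuous_on ((UNIV - {0}) \<times> (UNIV - {0}) :: ('a::complex_normed_vector \<times> 'a) set)
          (\<lambda>(x, y). angle x y)
        \<and> (\<lambda>(x, y). angle x y) ` ((UNIV - {0}) \<times> (UNIV - {0}) :: ('a \<times> 'a) set)
          \<subseteq> arccosC ` complex_square
        \<and> arccosC ` complex_square \<subset> setA)
     \<and> (\<forall>x::'a. x \<noteq> 0 \<longrightarrow> angle x x = 0)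
     \<and> (\<forall>x::'a. x \<noteq> 0 \<longrightarrow> angle (- x) x = complex_of_real pi)
     \<and> (\<forall>x y::'a. x \<noteq> 0 \<and> y \<noteq> 0 \<longrightarrow> angle x y = cnj (angle y x))
     \<and> (\<forall>x y::'a. x \<noteq> 0 \<and> y \<noteq> 0 \<longrightarrow>
          (\<forall>r s :: real. r > 0 \<and> s > 0 \<longrightarrow> angle (r *\<^sub>R x) (s *\<^sub>R y) = angle x y))
     \<and> (\<forall>x y::'a. x \<noteq> 0 \<and> y \<noteq> 0 \<longrightarrow> angle (- x) (- y) = angle x y)
     \<and> (\<forall>x y::'a. x \<noteq> 0 \<and> y \<noteq> 0 \<longrightarrow> angle x y + angle (- x) y = complex_of_real pi)
     \<and> (\<forall>x y::'a. x \<noteq> y \<and> complex_vector.independent {x, y} \<longrightarrow>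
          (let \<Theta> = (\<lambda>t :: real. angle x (y + t *\<^sub>R x)) in
             range \<Theta> \<subseteq> setA \<and> continuous_on UNIV \<Theta> \<and> inj \<Theta>
             \<and> (\<Theta> \<longlongrightarrow> complex_of_real pi) at_bot \<and> (\<Theta> \<longlongrightarrow> 0) at_top))"
proof (intro conjI allI impI)
  show "continuous_on ((UNIV - {0}) \<times> (UNIV - {0}) :: ('a \<times> 'a) set) (\<lambda>(x, y). angle x y)"
    unfolding case_prod_beta by (intro continuous_on_angle continuous_intros) auto
next
  show "angle (- x) (- y) = angle x y" if "x \<noteq> 0 \<and> y \<noteq> 0" for x y :: 'a
    using that by (simp add: angle_minus_minus)
next
  fix x y :: 'a assume "x \<noteq> y \<and> complex_vector.independent {x, y}"
  then have x: "x \<noteq> 0" and indep: "\<And>r::real. y \<noteq> r *\<^sub>R x"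
    using complex_independent_pair by blast+
  have ne: "y + r *\<^sub>R x \<noteq> 0" for r :: real
    using indep[of "- r"] by (auto simp: add_eq_0_iff2)
  have "continuous_on UNIV (\<lambda>t::real. angle x (y + t *\<^sub>R x))"
    using x ne by (intro continuous_on_angle continuous_intros) auto
  then show "let \<Theta> = (\<lambda>t :: real. angle x (y + t *\<^sub>R x)) in
      range \<Theta> \<subseteq> setA \<and> continuous_on UNIV \<Theta> \<and> inj \<Theta>
      \<and> (\<Theta> \<longlongrightarrow> complex_of_real pi) at_bot \<and> (\<Theta> \<longlongrightarrow> 0) at_top"
    using inj_angle_line[OF x indep] angle_line_at_bot[OF x ne] angle_line_at_top[OF x]
    by (auto simp: Let_def angle_in_setA x ne)
qed (auto simp: case_prod_beta arccosC_complex_square_psubset angle_self angle_minus_left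
    angle_scaleR intro!: angle_in_image intro: angle_cnj)

end
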